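(* Let $\eta>0$. Suppose that: (A1) each $f_i:\mathbb{R}^n\to\mathbb{R}$ ($i=1,\dots,m$) is differentiable, bounded from below, and $\|\nabla f_i(x)-\nabla f_i(y)\|\le L\|x-y\|$ for all $x,y\in\mathbb{R}^n$; (A2) there is $M>0$ such that $\|\nabla f_i(x)\|\le M$ for all $x\in\mathbb{R}^n$ and all $i$; (A3) for every $a\in\mathbb{R}^m$ the level set $\{x\in\mathbb{R}^n: f_i(x)\le a_i,\ i=1,\dots,m\}$ is bounded. Let $x:[0,+\infty)\to\mathbb{R}^n$ be a solution of $$\dot x(t)=-\mathbf{proj}_{C_\eta(x(t))}(0),\qquad x(0)=x_0 .$$ Then for all $t>0$ $$\min_{s\in[0,t]}\big\|\mathbf{proj}_{C_\eta(x(s))}(0)\big\|\le\frac{\sqrt{\min\limits_{i=1,\dots,m}\big(f_i(x_0)-\inf_{x\in\mathbb{R}^n}f_i(x)\big)}}{\sqrt{\eta}\,\sqrt{t}} .$$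
   Context: For $x\in\mathbb{R}^n$, $C_\eta(x)$ is the convex hull of $\left\{\frac{\nabla f_i(x)}{\|\nabla f_i(x)\|+\eta} : i=1,\dots,m\right\}$, and $\mathbf{proj}_C(x)$ is the Euclidean projection of $x$ onto a closed convex set $C$. A solution is a function, absolutely continuous on every compact subinterval, satisfying the differential equation for almost every $t$. *)

theory Defs
  imports "HOL-Analysis.Analysis"
begin

definition gradient :: "('a::euclidean_space \<Rightarrow> real) \<Rightarrow> 'a \<Rightarrow> 'a" where
  "gradient f x = (THE D. GDERIV f x :> D)"

lemma GDERIV_gradient:
  fixes f :: "'a::euclidean_space \<Rightarrow> real"
  assumes "f differentiable (at x)"
  shows "GDERIV f x :> gradient f x"
proof -
  obtain f' where f': "(f has_derivative f') (at x)"
    using assms by (auto simp: differentiable_def)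
  then have lin: "linear f'"
    using has_derivative_linear by blast
  have "f' = (\<lambda>h. inner h (adjoint f' 1))"
    using adjoint_works[OF lin] by (simp add: fun_eq_iff inner_commute)
  with f' have ex: "GDERIV f x :> adjoint f' 1"
    by (simp add: gderiv_def)
  have uniq: "D = E" if "GDERIV f x :> D" "GDERIV f x :> E" for D E
  proof -
    have "(\<lambda>h. inner h D) = (\<lambda>h. inner h E)"
      using that has_derivative_unique unfolding gderiv_def by blast
    then show ?thesis
      by (metis inner_commute vector_eq_rdot)
  qed
  show ?thesis
    unfolding gradient_def using ex uniq[OF _ ex] by (rule theI)
qed

definition normalized_gradient_hull ::
    "real \<Rightarrow> ('m \<Rightarrow> 'a::euclidean_space \<Rightarrow> real) \<Rightarrow> 'a \<Rightarrow> 'a set" where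
  "normalized_gradient_hull \<eta> f x =
     convex hull (range (\<lambda>i. gradient (f i) x /\<^sub>R (norm (gradient (f i) x) + \<eta>)))"

text \<open>The finite families of intervals are indexed by \<open>k < N\<close>. Only the interiors have to be
  disjoint, and degenerate intervals are admitted, since they contribute nothing to either sum.\<close>

definition absolutely_continuous_on :: "real \<Rightarrow> real \<Rightarrow> (real \<Rightarrow> 'a::real_normed_vector) \<Rightarrow> bool" where
  "absolutely_continuous_on a b x \<longleftrightarrow>
     (\<forall>\<epsilon>>0. \<exists>\<delta>>0. \<forall>N u v.
        (\<forall>k<N::nat. a \<le> u k \<and> u k \<le> v k \<and> v k \<le> b) \<longrightarrow>
        disjoint_family_on (\<lambda>k. {u k<..<v k}) {..<N} \<longrightarrow>
        (\<Sum>k<N. v k - u k) < \<delta> \<longrightarrow>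
        (\<Sum>k<N. norm (x (v k) - x (u k))) < \<epsilon>)"

text \<open>Solutions on \<open>[0, \<infinity>)\<close> of the autonomous equation with right-hand side \<open>V\<close>. A trajectory is a
  total function on the reals, of which only the restriction to \<open>[0, \<infinity>)\<close> is relevant.\<close>

definition is_solution ::
    "('a::euclidean_space \<Rightarrow> 'a) \<Rightarrow> 'a \<Rightarrow> (real \<Rightarrow> 'a) \<Rightarrow> bool" where
  "is_solution V x\<^sub>0 x \<longleftrightarrow>
     (\<forall>a b. 0 \<le> a \<and> a \<le> b \<longrightarrow> absolutely_continuous_on a b x) \<and>
     (AE t in lebesgue. 0 \<le> t \<longrightarrow> (x has_vector_derivative V (x t)) (at t within {0..})) \<and>
     x 0 = x\<^sub>0"

end

theory Submission
  imports Defs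
begin

text \<open>
  Along a solution every objective decreases, and the speed of the decrease is controlled by the
  step \<open>p(t)\<close>, the projection of \<open>0\<close> onto the hull of the normalized gradients. By the
  variational inequality of the projection, every point \<open>c\<close> of the hull satisfies
  \<open>c \<bullet> p \<ge> \<parallel>p\<parallel>\<^sup>2\<close>. For \<open>c = \<nabla>f\<^sub>i / (\<parallel>\<nabla>f\<^sub>i\<parallel> + \<eta>)\<close> this gives
  \<open>\<nabla>f\<^sub>i \<bullet> p \<ge> (\<parallel>\<nabla>f\<^sub>i\<parallel> + \<eta>) \<parallel>p\<parallel>\<^sup>2 \<ge> \<eta> \<parallel>p\<parallel>\<^sup>2\<close>
  (\<open>hull_projection_descent\<close>), so \<open>(f\<^sub>i \<circ> x)' \<le> -\<eta> \<parallel>p\<parallel>\<^sup>2\<close> at almost every time.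

  If \<open>m\<close> is the minimum of \<open>\<parallel>p\<parallel>\<close> on \<open>[0, t]\<close>, then \<open>f\<^sub>i \<circ> x\<close> has derivative at most
  \<open>-\<eta> m\<^sup>2\<close> almost everywhere there. It is absolutely continuous, because bounded gradients make
  \<open>f\<^sub>i\<close> Lipschitz, so it drops by at least \<open>\<eta> m\<^sup>2 t\<close>
  (\<open>absolutely_continuous_on_increment_bound\<close>). The drop cannot exceed
  \<open>f\<^sub>i(x\<^sub>0) - inf f\<^sub>i\<close>, and the claim is this inequality for the best index, solved
  for \<open>m\<close>. Bounding the derivative by a constant means that no integral of \<open>\<parallel>p\<parallel>\<^sup>2\<close>
  has to be formed.

  The minimum exists because the distance of \<open>0\<close> to the hull depends continuously on the
  finitely many generators (\<open>continuous_on_norm_hull_projection\<close>), and these are continuous in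
  time because the gradients are Lipschitz.
\<close>

section \<open>Absolutely continuous functions\<close>

text \<open>Sums over a tagged division are indexed by its elements, pairs of a tag and an interval, and
  not by an initial segment of the naturals, hence the transfer to arbitrary finite index sets.\<close>

lemma absolutely_continuous_on_finite_index:
  assumes "absolutely_continuous_on a b x" "\<epsilon> > 0"
  shows "\<exists>\<delta>>0. \<forall>(I :: 'i set) u v. finite I \<longrightarrow>
       (\<forall>k\<in>I. a \<le> u k \<and> u k \<le> v k \<and> v k \<le> b) \<longrightarrow>
       disjoint_family_on (\<lambda>k. {u k<..<v k}) I \<longrightarrow>
       (\<Sum>k\<in>I. v k - u k) < \<delta> \<longrightarrow>
       (\<Sum>k\<in>I. norm (x (v k) - x (u k))) < \<epsilon>"
proof -
  obtain \<delta> where "\<delta> > 0" and \<delta>: "\<And>(N::nat) u v.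
      (\<forall>k<N. a \<le> u k \<and> u k \<le> v k \<and> v k \<le> b) \<Longrightarrow>
      disjoint_family_on (\<lambda>k. {u k<..<v k}) {..<N} \<Longrightarrow>
      (\<Sum>k<N. v k - u k) < \<delta> \<Longrightarrow> (\<Sum>k<N. norm (x (v k) - x (u k))) < \<epsilon>"
    using assms unfolding absolutely_continuous_on_def by meson
  show ?thesis
  proof (intro exI[of _ \<delta>] conjI allI impI \<open>\<delta> > 0\<close>)
    fix I :: "'i set" and u v :: "'i \<Rightarrow> real"
    assume I: "finite I" "\<forall>k\<in>I. a \<le> u k \<and> u k \<le> v k \<and> v k \<le> b"
      and disj: "disjoint_family_on (\<lambda>k. {u k<..<v k}) I"
      and less: "(\<Sum>k\<in>I. v k - u k) < \<delta>"
    obtain h where h: "bij_betw h {..<card I} I"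
      using ex_bij_betw_nat_finite[OF I(1)] by (auto simp: atLeast0LessThan)
    have hI: "h k \<in> I" if "k < card I" for k
      using h that by (auto simp: bij_betw_def)
    have "(\<Sum>k<card I. norm (x (v (h k)) - x (u (h k)))) < \<epsilon>"
    proof (rule \<delta>)
      show "\<forall>k<card I. a \<le> u (h k) \<and> u (h k) \<le> v (h k) \<and> v (h k) \<le> b"
        using I(2) hI by blast
      show "disjoint_family_on (\<lambda>k. {u (h k)<..<v (h k)}) {..<card I}"
        unfolding disjoint_family_on_def
      proof (intro ballI impI)
        fix j k assume "j \<in> {..<card I}" "k \<in> {..<card I}" "j \<noteq> k"
        then have "h j \<in> I" "h k \<in> I" "h j \<noteq> h k"
          using hI bij_betw_imp_inj_on[OF h] by (auto dest: inj_onD)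
        then show "{u (h j)<..<v (h j)} \<inter> {u (h k)<..<v (h k)} = {}"
          using disj unfolding disjoint_family_on_def by blast
      qed
      show "(\<Sum>k<card I. v (h k) - u (h k)) < \<delta>"
        using less sum.reindex_bij_betw[OF h, of "\<lambda>k. v k - u k"] by simp
    qed
    then show "(\<Sum>k\<in>I. norm (x (v k) - x (u k))) < \<epsilon>"
      using sum.reindex_bij_betw[OF h, of "\<lambda>k. norm (x (v k) - x (u k))"] by simp
  qed
qed

lemma absolutely_continuous_on_imp_continuous_on:
  assumes "absolutely_continuous_on a b x"
  shows "continuous_on {a..b} x"
  unfolding continuous_on_iff
proof (intro ballI allI impI)
  fix s \<epsilon> :: real assume s: "s \<in> {a..b}" and "\<epsilon> > 0"
  obtain \<delta> where "\<delta> > 0" and \<delta>: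
    "\<And>(I :: unit set) u v. finite I \<Longrightarrow>
       (\<forall>k\<in>I. a \<le> u k \<and> u k \<le> v k \<and> v k \<le> b) \<Longrightarrow>
       disjoint_family_on (\<lambda>k. {u k<..<v k}) I \<Longrightarrow>
       (\<Sum>k\<in>I. v k - u k) < \<delta> \<Longrightarrow>
       (\<Sum>k\<in>I. norm (x (v k) - x (u k))) < \<epsilon>"
    using absolutely_continuous_on_finite_index[OF assms \<open>\<epsilon> > 0\<close>, where ?'i = unit] by meson
  have "dist (x r) (x s) < \<epsilon>" if r: "r \<in> {a..b}" "dist r s < \<delta>" for r
  proof -
    have "norm (x (max r s) - x (min r s)) < \<epsilon>"
      using \<delta>[of "{()}" "\<lambda>_. min r s" "\<lambda>_. max r s"] r s
      by (auto simp: disjoint_family_on_def dist_real_def)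
    then show ?thesis
      by (cases "r \<le> s") (auto simp: dist_norm norm_minus_commute)
  qed
  with \<open>\<delta> > 0\<close> show "\<exists>d>0. \<forall>r\<in>{a..b}. dist r s < d \<longrightarrow> dist (x r) (x s) < \<epsilon>"
    by blast
qed

lemma absolutely_continuous_on_lipschitz_compose:
  assumes ac: "absolutely_continuous_on a b x"
    and "M > 0" and lip: "\<And>y z. norm (g y - g z) \<le> M * norm (y - z)"
  shows "absolutely_continuous_on a b (\<lambda>t. g (x t))"
  unfolding absolutely_continuous_on_def
proof (intro allI impI)
  fix \<epsilon> :: real assume "\<epsilon> > 0"
  then have "\<epsilon> / M > 0"
    using \<open>M > 0\<close> by simp
  then obtain \<delta> where "\<delta> > 0" and \<delta>: "\<And>(N::nat) u v.
      (\<forall>k<N. a \<le> u k \<and> u k \<le> v k \<and> v k \<le> b) \<Longrightarrow>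
      disjoint_family_on (\<lambda>k. {u k<..<v k}) {..<N} \<Longrightarrow>
      (\<Sum>k<N. v k - u k) < \<delta> \<Longrightarrow> (\<Sum>k<N. norm (x (v k) - x (u k))) < \<epsilon> / M"
    using ac unfolding absolutely_continuous_on_def by meson
  show "\<exists>\<delta>>0. \<forall>N u v. (\<forall>k<N::nat. a \<le> u k \<and> u k \<le> v k \<and> v k \<le> b) \<longrightarrow>
        disjoint_family_on (\<lambda>k. {u k<..<v k}) {..<N} \<longrightarrow>
        (\<Sum>k<N. v k - u k) < \<delta> \<longrightarrow>
        (\<Sum>k<N. norm (g (x (v k)) - g (x (u k)))) < \<epsilon>"
  proof (intro exI[of _ \<delta>] conjI allI impI \<open>\<delta> > 0\<close>)
    fix N :: nat and u v :: "nat \<Rightarrow> real"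
    assume "\<forall>k<N. a \<le> u k \<and> u k \<le> v k \<and> v k \<le> b"
      "disjoint_family_on (\<lambda>k. {u k<..<v k}) {..<N}" "(\<Sum>k<N. v k - u k) < \<delta>"
    then have "(\<Sum>k<N. norm (x (v k) - x (u k))) < \<epsilon> / M"
      by (rule \<delta>)
    then have "M * (\<Sum>k<N. norm (x (v k) - x (u k))) < \<epsilon>"
      using \<open>M > 0\<close> by (simp add: field_simps)
    moreover have "(\<Sum>k<N. norm (g (x (v k)) - g (x (u k))))
        \<le> M * (\<Sum>k<N. norm (x (v k) - x (u k)))"
      unfolding sum_distrib_left by (intro sum_mono lip)
    ultimately show "(\<Sum>k<N. norm (g (x (v k)) - g (x (u k)))) < \<epsilon>"
      by simp
  qed
qed

text \<open>Only intervals containing \<open>s\<close> are considered, since a derivative at a single point controls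
  nothing else: the increment is split at \<open>s\<close>, and each half is compared with its linearization.
  This is the situation of a tag and its interval in a tagged division.\<close>

lemma derivative_bound_imp_local_increment_bound:
  fixes h :: "real \<Rightarrow> real"
  assumes der: "(h has_vector_derivative D) (at s within S)" and "D \<le> K" "\<epsilon> > 0"
  obtains d where "d > 0"
    "\<And>u v. u \<in> S \<Longrightarrow> v \<in> S \<Longrightarrow> u \<le> s \<Longrightarrow> s \<le> v \<Longrightarrow> u \<in> ball s d \<Longrightarrow> v \<in> ball s d \<Longrightarrow>
       h v - h u \<le> (K + \<epsilon>) * (v - u)"
proof -
  have "\<exists>d>0. \<forall>y\<in>S. norm (y - s) < d \<longrightarrow> norm (h y - h s - (y - s) *\<^sub>R D) \<le> \<epsilon> * norm (y - s)"
    using der \<open>\<epsilon> > 0\<close> unfolding has_vector_derivative_def has_derivative_within_alt by blast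
  then obtain d where "d > 0"
    and d: "\<And>y. y \<in> S \<Longrightarrow> norm (y - s) < d \<Longrightarrow> norm (h y - h s - (y - s) * D) \<le> \<epsilon> * norm (y - s)"
    by auto
  show ?thesis
  proof (rule that[OF \<open>d > 0\<close>])
    fix u v assume uv: "u \<in> S" "v \<in> S" "u \<le> s" "s \<le> v" "u \<in> ball s d" "v \<in> ball s d"
    have "\<bar>h u - h s - (u - s) * D\<bar> \<le> \<epsilon> * (s - u)" "\<bar>h v - h s - (v - s) * D\<bar> \<le> \<epsilon> * (v - s)"
      using d[of u] d[of v] uv by (auto simp: dist_real_def)
    then have "h v - h u \<le> (D + \<epsilon>) * (v - u)"
      by (simp add: algebra_simps abs_le_iff)
    also have "\<dots> \<le> (K + \<epsilon>) * (v - u)"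
      using \<open>D \<le> K\<close> uv by (intro mult_right_mono) auto
    finally show "h v - h u \<le> (K + \<epsilon>) * (v - u)" .
  qed
qed

lemma negligible_open_cover:
  assumes "negligible E" "e > 0"
  obtains U where "open U" "E \<subseteq> U" "U \<in> lmeasurable" "measure lebesgue U < e"
proof -
  have E: "E \<in> null_sets lebesgue" "E \<in> sets lebesgue"
    using assms(1) by (auto simp: negligible_iff_null_sets)
  obtain U where U: "open U" "E \<subseteq> U" "U - E \<in> lmeasurable" "emeasure lebesgue (U - E) < ennreal e"
    using sets_lebesgue_outer_open[OF E(2) \<open>e > 0\<close>] by metis
  have "E \<in> lmeasurable"
    using assms(1) by (rule negligible_imp_measurable)
  with U have "U \<in> lmeasurable"
    using fmeasurable.Un[of "U - E" lebesgue E] by (simp add: Un_absorb2)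
  moreover have "measure lebesgue U < e"
  proof -
    have "measure lebesgue (U - E) = measure lebesgue U"
      using \<open>U \<in> lmeasurable\<close> E(1) by (simp add: measure_Diff_null_set fmeasurableD)
    then show ?thesis
      using U(3,4) \<open>e > 0\<close> by (simp add: emeasure_eq_measure2 ennreal_less_iff)
  qed
  ultimately show thesis
    using U that by blast
qed

text \<open>Additivity of the measure applies to the open intervals, which are disjoint even where the
  closed ones share an endpoint.\<close>

lemma sum_interval_lengths_le_measure:
  fixes u v :: "'i \<Rightarrow> real"
  assumes "finite I" "disjoint_family_on (\<lambda>k. {u k<..<v k}) I"
    and "\<And>k. k \<in> I \<Longrightarrow> u k \<le> v k" "\<And>k. k \<in> I \<Longrightarrow> {u k..v k} \<subseteq> U" "U \<in> lmeasurable"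
  shows "(\<Sum>k\<in>I. v k - u k) \<le> measure lebesgue U"
proof -
  have "(\<Sum>k\<in>I. v k - u k) = (\<Sum>k\<in>I. measure lebesgue {u k<..<v k})"
    using assms(3) by (intro sum.cong) auto
  also have "\<dots> = measure lebesgue (\<Union>k\<in>I. {u k<..<v k})"
    using assms(1-3) by (intro measure_finite_Union[symmetric]) auto
  also have "\<dots> \<le> measure lebesgue U"
  proof (rule measure_mono_fmeasurable)
    show "(\<Union>k\<in>I. {u k<..<v k}) \<subseteq> U"
      using assms(4) by (fastforce simp: subset_iff)
    show "(\<Union>k\<in>I. {u k<..<v k}) \<in> sets lebesgue"
      using assms(1) by auto
  qed (use assms(5) in auto)
  finally show ?thesis .
qed

text \<open>A covering argument replaces integration. Take a division of \<open>[a, b]\<close> fine enough that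
  intervals tagged outside \<open>E\<close> respect the derivative bound up to \<open>\<epsilon>\<close>, while those tagged in \<open>E\<close>
  lie in an open set of tiny measure. Absolute continuity makes the total increment over the
  latter negligible.\<close>

lemma absolutely_continuous_on_increment_bound:
  fixes h :: "real \<Rightarrow> real"
  assumes "a \<le> b" and ac: "absolutely_continuous_on a b h" and E: "negligible E"
    and der: "\<And>s. s \<in> {a..b} - E \<Longrightarrow> \<exists>D\<le>K. (h has_vector_derivative D) (at s within {a..b})"
  shows "h b - h a \<le> K * (b - a)"
proof -
  have approx: "h b - h a \<le> (K + \<epsilon>) * (b - a) + \<epsilon> + \<bar>K + \<epsilon>\<bar> * \<epsilon>" if "\<epsilon> > 0" for \<epsilon>
  proof -
    obtain \<delta> where "\<delta> > 0" and \<delta>: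
      "\<And>(I :: (real \<times> real set) set) u v. finite I \<Longrightarrow>
         (\<forall>k\<in>I. a \<le> u k \<and> u k \<le> v k \<and> v k \<le> b) \<Longrightarrow>
         disjoint_family_on (\<lambda>k. {u k<..<v k}) I \<Longrightarrow>
         (\<Sum>k\<in>I. v k - u k) < \<delta> \<Longrightarrow>
         (\<Sum>k\<in>I. norm (h (v k) - h (u k))) < \<epsilon>"
      using absolutely_continuous_on_finite_index[OF ac \<open>\<epsilon> > 0\<close>, where ?'i = "real \<times> real set"]
      by meson
    \<comment> \<open>The bound \<open>\<delta>\<close> is for absolute continuity, the bound \<open>\<epsilon>\<close> for the linear term
      \<open>(K + \<epsilon>) * length\<close>, which the estimate below charges to every interval and has to take
      back on those tagged in \<open>E\<close>.\<close>
    obtain U where U: "open U" "E \<subseteq> U" "U \<in> lmeasurable" "measure lebesgue U < min \<delta> \<epsilon>"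
      using negligible_open_cover[OF E, of "min \<delta> \<epsilon>"] \<open>\<delta> > 0\<close> \<open>\<epsilon> > 0\<close> by auto
    have "\<exists>d>0. (s \<in> E \<longrightarrow> ball s d \<subseteq> U) \<and> (s \<in> {a..b} - E \<longrightarrow>
        (\<forall>u v. u \<in> {a..b} \<longrightarrow> v \<in> {a..b} \<longrightarrow> u \<le> s \<longrightarrow> s \<le> v \<longrightarrow> u \<in> ball s d \<longrightarrow> v \<in> ball s d \<longrightarrow>
          h v - h u \<le> (K + \<epsilon>) * (v - u)))" for s
    proof (cases "s \<in> E")
      case True
      then show ?thesis
        using U(1,2) by (auto simp: open_contains_ball)
    next
      case False
      show ?thesis
      proof (cases "s \<in> {a..b}")
        case True
        with False obtain D where "D \<le> K" "(h has_vector_derivative D) (at s within {a..b})"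
          using der by blast
        then show ?thesis
          using derivative_bound_imp_local_increment_bound[of h D s "{a..b}" K \<epsilon>] \<open>\<epsilon> > 0\<close> False
          by metis
      qed (use False zero_less_one in blast)
    qed
    then obtain d where d: "\<And>s. d s > 0" "\<And>s. s \<in> E \<Longrightarrow> ball s (d s) \<subseteq> U"
      and d_incr: "\<And>s u v. \<lbrakk>s \<in> {a..b} - E; u \<in> {a..b}; v \<in> {a..b}; u \<le> s; s \<le> v;
          u \<in> ball s (d s); v \<in> ball s (d s)\<rbrakk> \<Longrightarrow> h v - h u \<le> (K + \<epsilon>) * (v - u)"
      by metis
    obtain p where p: "p tagged_division_of {a..b}" and fine: "(\<lambda>s. ball s (d s)) fine p"
      using fine_division_exists_real[OF gauge_ball_dependent] d(1) by metis
    define lo hi where "lo k = Inf (snd k)" and "hi k = Sup (snd k)" for k :: "real \<times> real set"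
    note pD = tagged_division_ofD[OF p]
    have endpoints: "snd k = {lo k..hi k} \<and> lo k \<le> fst k \<and> fst k \<le> hi k \<and> a \<le> lo k \<and> hi k \<le> b \<and>
        {lo k..hi k} \<subseteq> ball (fst k) (d (fst k))" if kp: "k \<in> p" for k
    proof -
      obtain s J where k: "k = (s, J)"
        by (cases k)
      obtain u v where J: "J = {u..v}"
        using pD(4)[of s J] kp k by auto
      have "s \<in> J" "J \<subseteq> {a..b}" "J \<subseteq> ball s (d s)"
        using pD(2,3)[of s J] fineD[OF fine, of s J] kp k by auto
      with J k show ?thesis
        by (auto simp: lo_def hi_def)
    qed
    have disj: "disjoint_family_on (\<lambda>k. {lo k<..<hi k}) p"
      unfolding disjoint_family_on_def
    proof (intro ballI impI)
      fix j k assume jk: "j \<in> p" "k \<in> p" "j \<noteq> k"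
      then have "interior (snd j) \<inter> interior (snd k) = {}"
        using pD(5)[of "fst j" "snd j" "fst k" "snd k"] by simp
      then show "{lo j<..<hi j} \<inter> {lo k<..<hi k} = {}"
        using endpoints[OF jk(1)] endpoints[OF jk(2)] by (simp add: interior_atLeastAtMost_real)
    qed
    define q where "q = {k \<in> p. fst k \<in> E}"
    have q: "q \<subseteq> p" "finite q" "finite p"
      using pD(1) by (auto simp: q_def)
    have disj_q: "disjoint_family_on (\<lambda>k. {lo k<..<hi k}) q"
      using disj q(1) by (rule disjoint_family_on_mono[rotated])
    have len_q: "(\<Sum>k\<in>q. hi k - lo k) < min \<delta> \<epsilon>"
    proof -
      have "(\<Sum>k\<in>q. hi k - lo k) \<le> measure lebesgue U"
      proof (rule sum_interval_lengths_le_measure[OF q(2) disj_q])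
        fix k assume "k \<in> q"
        then have "k \<in> p" "fst k \<in> E"
          by (auto simp: q_def)
        then show "lo k \<le> hi k" "{lo k..hi k} \<subseteq> U"
          using endpoints[of k] d(2)[of "fst k"] by auto
      qed (use U in auto)
      with U(4) show ?thesis
        by simp
    qed
    have incr_q: "(\<Sum>k\<in>q. norm (h (hi k) - h (lo k))) < \<epsilon>"
    proof (rule \<delta>[OF q(2) _ disj_q])
      show "\<forall>k\<in>q. a \<le> lo k \<and> lo k \<le> hi k \<and> hi k \<le> b"
      proof
        fix k assume "k \<in> q"
        then show "a \<le> lo k \<and> lo k \<le> hi k \<and> hi k \<le> b"
          using endpoints[of k] q(1) by auto
      qed
    qed (use len_q in simp)
    have telescope: "(\<Sum>k\<in>p. g (hi k) - g (lo k)) = g b - g a" for g :: "real \<Rightarrow> real"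
      using additive_tagged_division_1[OF \<open>a \<le> b\<close> p, of g]
      by (simp add: lo_def hi_def case_prod_unfold)
    let ?err = "\<lambda>k. norm (h (hi k) - h (lo k)) + \<bar>K + \<epsilon>\<bar> * (hi k - lo k)"
    have "h b - h a = (\<Sum>k\<in>p. h (hi k) - h (lo k))"
      by (simp add: telescope)
    also have "\<dots> \<le> (\<Sum>k\<in>p. (K + \<epsilon>) * (hi k - lo k) + (if k \<in> q then ?err k else 0))"
    proof (rule sum_mono)
      fix k assume k: "k \<in> p"
      show "h (hi k) - h (lo k) \<le> (K + \<epsilon>) * (hi k - lo k) + (if k \<in> q then ?err k else 0)"
      proof (cases "k \<in> q")
        case True
        have "- ((K + \<epsilon>) * (hi k - lo k)) \<le> \<bar>K + \<epsilon>\<bar> * (hi k - lo k)"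
          using mult_right_mono[OF abs_ge_minus_self, of "hi k - lo k" "K + \<epsilon>"] endpoints[OF k]
          by (simp only: mult_minus_left) simp
        with True show ?thesis
          by simp
      next
        case False
        with k have "fst k \<notin> E"
          by (simp add: q_def)
        have ball: "lo k \<in> ball (fst k) (d (fst k))" "hi k \<in> ball (fst k) (d (fst k))"
          using endpoints[OF k] by (meson atLeastAtMost_iff order_refl order_trans subsetD)+
        have "h (hi k) - h (lo k) \<le> (K + \<epsilon>) * (hi k - lo k)"
          by (rule d_incr[OF _ _ _ _ _ ball]) (use endpoints[OF k] \<open>fst k \<notin> E\<close> in auto)
        with False show ?thesis
          by simp
      qed
    qed
    also have "\<dots> = (K + \<epsilon>) * (\<Sum>k\<in>p. hi k - lo k) + (\<Sum>k\<in>q. ?err k)"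
      using q by (simp add: sum.distrib sum_distrib_left sum.inter_restrict[symmetric] Int_absorb1)
    also have "\<dots> = (K + \<epsilon>) * (b - a) + (\<Sum>k\<in>q. norm (h (hi k) - h (lo k)))
        + \<bar>K + \<epsilon>\<bar> * (\<Sum>k\<in>q. hi k - lo k)"
      using telescope[of "\<lambda>s. s"] by (simp add: sum.distrib sum_distrib_left)
    also have "\<dots> \<le> (K + \<epsilon>) * (b - a) + \<epsilon> + \<bar>K + \<epsilon>\<bar> * \<epsilon>"
      using incr_q len_q by (intro add_mono[OF add_left_mono mult_left_mono]) auto
    finally show ?thesis .
  qed
  have "((\<lambda>\<epsilon>. (K + \<epsilon>) * (b - a) + \<epsilon> + \<bar>K + \<epsilon>\<bar> * \<epsilon>)
      \<longlongrightarrow> (K + 0) * (b - a) + 0 + \<bar>K + 0\<bar> * 0) (at_right 0)"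
    by (intro tendsto_intros)
  moreover have "eventually (\<lambda>\<epsilon>. h b - h a \<le> (K + \<epsilon>) * (b - a) + \<epsilon> + \<bar>K + \<epsilon>\<bar> * \<epsilon>) (at_right 0)"
    using approx by (auto simp: eventually_at_right_field intro!: exI[of _ 1])
  ultimately have "h b - h a \<le> (K + 0) * (b - a) + 0 + \<bar>K + 0\<bar> * 0"
    by (rule tendsto_lowerbound) simp
  then show ?thesis
    by simp
qed

section \<open>Projecting the origin onto a finitely generated hull\<close>

lemma norm_closest_point_origin_le:
  assumes "closed S" "z \<in> S"
  shows "norm (closest_point S 0) \<le> norm z"
  using closest_point_le[OF assms, of 0] by simp

lemma compact_convex_hull_range:
  fixes c :: "'m::finite \<Rightarrow> 'a::euclidean_space"
  shows "compact (convex hull (range c))"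
  by (simp add: finite_imp_compact_convex_hull)

text \<open>Generators that move by at most \<open>e\<close> move the hull by at most \<open>e\<close>: the hull of the \<open>c i\<close> lies
  in the convex set obtained by thickening the other hull with a ball of radius \<open>e\<close>.\<close>

lemma norm_hull_projection_perturb:
  fixes c d :: "'m::finite \<Rightarrow> 'a::euclidean_space"
  assumes near: "\<And>i. dist (c i) (d i) \<le> e"
  shows "norm (closest_point (convex hull (range d)) 0) \<le> norm (closest_point (convex hull (range c)) 0) + e"
proof -
  let ?C = "convex hull (range c)" and ?D = "convex hull (range d)"
  let ?T = "\<Union>q\<in>?D. \<Union>r\<in>cball 0 e. {q + r}"
  have "?C \<subseteq> ?T"
  proof (rule hull_minimal)
    show "convex ?T"
      by (intro convex_sums) auto
    show "range c \<subseteq> ?T"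
    proof safe
      fix i
      have "d i \<in> ?D" "c i - d i \<in> cball 0 e" "c i = d i + (c i - d i)"
        using near[of i] by (auto simp: hull_inc dist_norm norm_minus_commute)
      then show "c i \<in> ?T"
        by blast
    qed
  qed
  moreover have "closest_point ?C 0 \<in> ?C"
    by (intro closest_point_in_set compact_imp_closed compact_convex_hull_range) simp
  ultimately obtain q r where qr: "q \<in> ?D" "norm r \<le> e" "closest_point ?C 0 = q + r"
    by (auto simp: subset_iff)
  have "norm (closest_point ?D 0) \<le> norm q"
    using qr(1) by (intro norm_closest_point_origin_le compact_imp_closed compact_convex_hull_range)
  also have "\<dots> \<le> norm (q + r) + norm r"
    using norm_triangle_ineq4[of "q + r" r] by simp
  finally show ?thesis
    using qr by simp
qed

lemma continuous_on_norm_hull_projection: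
  fixes c :: "'m::finite \<Rightarrow> 'b::metric_space \<Rightarrow> 'a::euclidean_space"
  assumes "\<And>i. continuous_on S (c i)"
  shows "continuous_on S (\<lambda>y. norm (closest_point (convex hull (range (\<lambda>i. c i y))) 0))"
  unfolding continuous_on_def
proof
  fix y assume "y \<in> S"
  let ?n = "\<lambda>y. norm (closest_point (convex hull (range (\<lambda>i. c i y))) 0)"
  show "(?n \<longlongrightarrow> ?n y) (at y within S)"
  proof (rule tendstoI)
    fix e :: real assume "e > 0"
    have "\<forall>\<^sub>F z in at y within S. dist (c i z) (c i y) < e / 2" for i
      using assms[of i] \<open>y \<in> S\<close> \<open>e > 0\<close> unfolding continuous_on_def by (intro tendstoD) auto
    then have "\<forall>\<^sub>F z in at y within S. \<forall>i. dist (c i z) (c i y) < e / 2"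
      by (rule eventually_all_finite)
    then show "\<forall>\<^sub>F z in at y within S. dist (?n z) (?n y) < e"
    proof eventually_elim
      case (elim z)
      have "?n y \<le> ?n z + e / 2"
        using elim by (intro norm_hull_projection_perturb) (auto intro: less_imp_le)
      moreover have "?n z \<le> ?n y + e / 2"
        using elim by (intro norm_hull_projection_perturb) (auto intro: less_imp_le simp: dist_commute)
      ultimately show ?case
        using \<open>e > 0\<close> by (simp add: dist_real_def)
    qed
  qed
qed

text \<open>The variational inequality \<open>(0 - p) \<bullet> (c - p) \<le> 0\<close> at the generator
  \<open>c = g i / (\<parallel>g i\<parallel> + \<eta>)\<close>, multiplied by its denominator.\<close>

lemma hull_projection_descent:
  fixes g :: "'m::finite \<Rightarrow> 'a::euclidean_space"
  assumes "\<eta> > 0"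
  defines "p \<equiv> closest_point (convex hull (range (\<lambda>i. g i /\<^sub>R (norm (g i) + \<eta>)))) 0"
  shows "g i \<bullet> p \<ge> \<eta> * (norm p)\<^sup>2"
proof -
  let ?C = "convex hull (range (\<lambda>i. g i /\<^sub>R (norm (g i) + \<eta>)))"
  let ?c = "g i /\<^sub>R (norm (g i) + \<eta>)"
  have pos: "norm (g i) + \<eta> > 0"
    using \<open>\<eta> > 0\<close> by (simp add: add_nonneg_pos)
  have "?c \<in> ?C"
    by (simp add: hull_inc)
  then have "(0 - p) \<bullet> (?c - p) \<le> 0"
    unfolding p_def
    by (intro closest_point_dot convex_convex_hull compact_imp_closed compact_convex_hull_range)
  then have "(norm p)\<^sup>2 \<le> ?c \<bullet> p"
    by (simp add: inner_diff_right inner_commute power2_norm_eq_inner)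
  also have "\<dots> = (g i \<bullet> p) / (norm (g i) + \<eta>)"
    by (simp add: divide_inverse mult.commute)
  finally have "(norm (g i) + \<eta>) * (norm p)\<^sup>2 \<le> g i \<bullet> p"
    using pos by (simp add: pos_le_divide_eq mult.commute)
  moreover have "\<eta> * (norm p)\<^sup>2 \<le> (norm (g i) + \<eta>) * (norm p)\<^sup>2"
    by (intro mult_right_mono) auto
  ultimately show ?thesis
    by simp
qed

section \<open>Gradients\<close>

lemma bounded_gradient_imp_lipschitz:
  fixes f :: "'a::euclidean_space \<Rightarrow> real"
  assumes "\<And>y. f differentiable (at y)" and bound: "\<And>y. norm (gradient f y) \<le> M"
  shows "norm (f y - f z) \<le> M * norm (y - z)"
proof (rule differentiable_bound[OF convex_UNIV])
  show "(f has_derivative (\<lambda>h. h \<bullet> gradient f w)) (at w)" for w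
    using GDERIV_gradient[OF assms(1)] by (simp add: gderiv_def)
  show "onorm (\<lambda>h. h \<bullet> gradient f w) \<le> M" for w
  proof (rule onorm_bound)
    show "0 \<le> M"
      using bound[of w] norm_ge_zero order_trans by blast
    show "norm (h \<bullet> gradient f w) \<le> M * norm h" for h
      using Cauchy_Schwarz_ineq2[of h "gradient f w"]
        mult_left_mono[OF bound[of w] norm_ge_zero[of h]] by (simp add: mult.commute)
  qed
qed auto

lemma has_vector_derivative_gradient_compose:
  fixes f :: "'a::euclidean_space \<Rightarrow> real"
  assumes "f differentiable (at (x s))" "(x has_vector_derivative w) (at s within S)"
  shows "((\<lambda>s. f (x s)) has_vector_derivative w \<bullet> gradient f (x s)) (at s within S)"
proof -
  have "(f has_derivative (\<lambda>h. h \<bullet> gradient f (x s))) (at (x s) within x ` S)"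
    using GDERIV_gradient[OF assms(1)] unfolding gderiv_def by (rule has_derivative_at_withinI)
  from vector_derivative_diff_chain_within[OF assms(2) this] show ?thesis
    by (simp add: o_def)
qed

lemma lipschitz_imp_continuous_on:
  fixes g :: "'a::real_normed_vector \<Rightarrow> 'b::real_normed_vector"
  assumes "\<And>y z. norm (g y - g z) \<le> L * norm (y - z)"
  shows "continuous_on S g"
proof -
  \<comment> \<open>A Lipschitz constant has to be nonnegative.\<close>
  have "\<bar>L\<bar>-lipschitz_on S g"
  proof (rule lipschitz_onI)
    show "dist (g y) (g z) \<le> \<bar>L\<bar> * dist y z" for y z
      using order_trans[OF assms mult_right_mono[OF abs_ge_self norm_ge_zero]]
      by (simp add: dist_norm)
  qed simp
  then show ?thesis
    by (rule lipschitz_on_continuous_on)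
qed

section \<open>The convergence rate\<close>

theorem theorem3p8:
  fixes f :: "'m::finite \<Rightarrow> real ^ 'n \<Rightarrow> real"
    and x :: "real \<Rightarrow> real ^ 'n" and x\<^sub>0 :: "real ^ 'n" and \<eta> L :: real
  assumes "\<eta> > 0"
    and A1_differentiable: "\<And>i y. f i differentiable (at y)"
    and A1_bounded_below: "\<And>i. bdd_below (range (f i))"
    and A1_Lipschitz: "\<And>i y z. norm (gradient (f i) y - gradient (f i) z) \<le> L * norm (y - z)"
    and A2: "\<exists>M>0. \<forall>i y. norm (gradient (f i) y) \<le> M"
    and A3: "\<And>a :: real ^ 'm. bounded {y. \<forall>i. f i y \<le> a $ i}"
    and sol: "is_solution (\<lambda>y. - closest_point (normalized_gradient_hull \<eta> f y) 0) x\<^sub>0 x"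
  shows "\<forall>t>0. \<exists>s.
    is_arg_min (\<lambda>s. norm (closest_point (normalized_gradient_hull \<eta> f (x s)) 0)) (\<lambda>s. s \<in> {0..t}) s \<and>
    norm (closest_point (normalized_gradient_hull \<eta> f (x s)) 0)
      \<le> sqrt (Min (range (\<lambda>i. f i x\<^sub>0 - (INF y. f i y)))) / (sqrt \<eta> * sqrt t)"
proof (intro allI impI)
  fix t :: real assume "t > 0"
  let ?p = "\<lambda>y. closest_point (normalized_gradient_hull \<eta> f y) 0"
  have ac: "absolutely_continuous_on 0 t x"
    and ae: "AE s in lebesgue. 0 \<le> s \<longrightarrow> (x has_vector_derivative - ?p (x s)) (at s within {0..})"
    and x0: "x 0 = x\<^sub>0"
    using sol \<open>t > 0\<close> unfolding is_solution_def by auto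
  obtain M where "M > 0" and M: "\<And>i y. norm (gradient (f i) y) \<le> M"
    using A2 by blast
  have "continuous_on {0..t} (\<lambda>s. norm (?p (x s)))"
  proof -
    have denom: "norm (gradient (f i) y) + \<eta> \<noteq> 0" for i y
      using norm_ge_zero[of "gradient (f i) y"] \<open>\<eta> > 0\<close> by linarith
    have "continuous_on (x ` {0..t}) (\<lambda>y. norm (?p y))"
      unfolding normalized_gradient_hull_def
      by (intro continuous_on_norm_hull_projection continuous_intros
          lipschitz_imp_continuous_on[OF A1_Lipschitz] ballI denom)
    then show ?thesis
      using absolutely_continuous_on_imp_continuous_on[OF ac] by (rule continuous_on_compose2) auto
  qed
  then obtain s where s: "s \<in> {0..t}" and s_min: "\<And>r. r \<in> {0..t} \<Longrightarrow> norm (?p (x s)) \<le> norm (?p (x r))"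
    using continuous_attains_inf[of "{0..t}" "\<lambda>s. norm (?p (x s))"] \<open>t > 0\<close> by auto
  let ?m = "norm (?p (x s))"
  obtain E where E: "negligible E"
    and x': "\<And>r. r \<in> {0..t} - E \<Longrightarrow> (x has_vector_derivative - ?p (x r)) (at r within {0..t})"
  proof -
    obtain E where E: "E \<in> null_sets lebesgue"
      and sub: "\<And>r. r \<in> space lebesgue - E \<Longrightarrow> 0 \<le> r \<longrightarrow>
        (x has_vector_derivative - ?p (x r)) (at r within {0..})"
      by (rule AE_E3[OF ae]) blast
    show thesis
    proof
      show "negligible E"
        using E by (simp add: negligible_iff_null_sets)
      fix r assume "r \<in> {0..t} - E"
      then have "(x has_vector_derivative - ?p (x r)) (at r within {0..})"
        using sub by auto
      then show "(x has_vector_derivative - ?p (x r)) (at r within {0..t})"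
        by (rule has_vector_derivative_within_subset) auto
    qed
  qed
  have drop: "\<eta> * ?m\<^sup>2 * t \<le> f i x\<^sub>0 - (INF y. f i y)" for i
  proof -
    have "f i (x t) - f i (x 0) \<le> - (\<eta> * ?m\<^sup>2) * (t - 0)"
    proof (rule absolutely_continuous_on_increment_bound[OF _ _ E])
      show "absolutely_continuous_on 0 t (\<lambda>s. f i (x s))"
        by (rule absolutely_continuous_on_lipschitz_compose[OF ac \<open>M > 0\<close>
              bounded_gradient_imp_lipschitz[OF A1_differentiable M]])
      fix r assume r: "r \<in> {0..t} - E"
      have "((\<lambda>s. f i (x s)) has_vector_derivative - ?p (x r) \<bullet> gradient (f i) (x r)) (at r within {0..t})"
        by (rule has_vector_derivative_gradient_compose[OF A1_differentiable x'[OF r]])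
      moreover have "- ?p (x r) \<bullet> gradient (f i) (x r) \<le> - (\<eta> * ?m\<^sup>2)"
      proof -
        have "\<eta> * ?m\<^sup>2 \<le> \<eta> * (norm (?p (x r)))\<^sup>2"
          using s_min[of r] r \<open>\<eta> > 0\<close> by (intro mult_left_mono power_mono) auto
        also have "\<dots> \<le> gradient (f i) (x r) \<bullet> ?p (x r)"
          using hull_projection_descent[OF \<open>\<eta> > 0\<close>, of "\<lambda>i. gradient (f i) (x r)" i]
          by (simp add: normalized_gradient_hull_def)
        finally show ?thesis
          by (simp add: inner_commute)
      qed
      ultimately show "\<exists>D\<le>- (\<eta> * ?m\<^sup>2). ((\<lambda>s. f i (x s)) has_vector_derivative D) (at r within {0..t})"
        by blast
    qed (use \<open>t > 0\<close> in auto)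
    moreover have "(INF y. f i y) \<le> f i (x t)"
      by (rule cINF_lower[OF A1_bounded_below]) simp
    ultimately show ?thesis
      by (simp add: x0)
  qed
  let ?D = "Min (range (\<lambda>i. f i x\<^sub>0 - (INF y. f i y)))"
  have "\<eta> * ?m\<^sup>2 * t \<le> ?D"
    using drop by (subst Min_ge_iff) auto
  then have "?m\<^sup>2 \<le> ?D / (\<eta> * t)"
    using \<open>\<eta> > 0\<close> \<open>t > 0\<close> by (simp add: pos_le_divide_eq mult_ac)
  then have "?m \<le> sqrt (?D / (\<eta> * t))"
    by (rule real_le_rsqrt)
  also have "\<dots> = sqrt ?D / (sqrt \<eta> * sqrt t)"
    by (simp add: real_sqrt_divide real_sqrt_mult)
  finally show "\<exists>s. is_arg_min (\<lambda>s. norm (?p (x s))) (\<lambda>s. s \<in> {0..t}) s \<and>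
      norm (?p (x s)) \<le> sqrt ?D / (sqrt \<eta> * sqrt t)"
    using s s_min by (auto simp: is_arg_min_linorder)
qed

end
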